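(* Let $r$ be an even integer and let $n$ be a positive integer. Then \[ 5F_{3r}\sum_{k=1}^n F_{2rk}^3 = F_{rn}F_{rn+r}\left(L_{rn}L_{rn+r}L_{2rn+r}-2L_r^2\right). \]
   Context: The Fibonacci numbers $F_m$ and Lucas numbers $L_m$ are defined for all $m\in\mathbb{Z}$ by $F_m=F_{m-1}+F_{m-2}$, $F_0=0$, $F_1=1$, and $L_m=L_{m-1}+L_{m-2}$, $L_0=2$, $L_1=1$; in particular $F_{-m}=(-1)^{m-1}F_m$ and $L_{-m}=(-1)^mL_m$. *)

theory Defs
  imports "HOL-Number_Theory.Fib"
begin

text \<open>
  Fibonacci and Lucas numbers with arbitrary integer index. For negative indices the recurrence
  is run backwards; that it then holds at every integer is proved below.
\<close>

function fibZ :: "int \<Rightarrow> int" where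
  "fibZ m = (if m = 0 then 0 else if m = 1 then 1
             else if m > 1 then fibZ (m - 1) + fibZ (m - 2)
             else fibZ (m + 2) - fibZ (m + 1))"
  by pat_completeness auto
termination by (relation "measure (\<lambda>m. nat \<bar>2 * m - 1\<bar>)") auto

function lucasZ :: "int \<Rightarrow> int" where
  "lucasZ m = (if m = 0 then 2 else if m = 1 then 1
               else if m > 1 then lucasZ (m - 1) + lucasZ (m - 2)
               else lucasZ (m + 2) - lucasZ (m + 1))"
  by pat_completeness auto
termination by (relation "measure (\<lambda>m. nat \<bar>2 * m - 1\<bar>)") auto

declare fibZ.simps [simp del] lucasZ.simps [simp del]

lemma fibZ_0 [simp]: "fibZ 0 = 0" and fibZ_1 [simp]: "fibZ 1 = 1"
  by (simp_all add: fibZ.simps)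

lemma lucasZ_0 [simp]: "lucasZ 0 = 2" and lucasZ_1 [simp]: "lucasZ 1 = 1"
  by (simp_all add: lucasZ.simps)

lemma fibZ_rec: "fibZ m = fibZ (m - 1) + fibZ (m - 2)"
proof (cases "m > 1")
  case True
  then show ?thesis by (simp add: fibZ.simps [of m])
next
  case False
  then show ?thesis by (simp add: fibZ.simps [of "m - 2"])
qed

lemma lucasZ_rec: "lucasZ m = lucasZ (m - 1) + lucasZ (m - 2)"
proof (cases "m > 1")
  case True
  then show ?thesis by (simp add: lucasZ.simps [of m])
next
  case False
  then show ?thesis by (simp add: lucasZ.simps [of "m - 2"])
qed

lemma fibZ_of_nat: "fibZ (int n) = int (fib n)"
proof (induction n rule: fib.induct)
  case (3 n)
  then show ?case using fibZ_rec [of "int (Suc (Suc n))"] by (simp add: algebra_simps)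
qed simp_all

end

theory Submission
  imports Defs
begin

text \<open>
  Both sides vanish for \<open>n = 0\<close>, so it suffices that the right-hand side telescopes. Put
  \<open>m = r(n + 1)\<close>; the step from \<open>n\<close> to \<open>n + 1\<close> replaces the index pair \<open>(m - r, m)\<close> by
  \<open>(m, m + r)\<close>. The sign in the product formula
  \<open>F(a)L(b) = F(a + b) + (-1)\<^sup>b F(a - b)\<close> disappears because \<open>b = 2m \<plusminus> r\<close> is even, so
  together with \<open>F(a)L(a) = F(2a)\<close> it gives
  \<open>F(m \<plusminus> r) L(m \<plusminus> r) L(2m \<plusminus> r) = F(4m \<plusminus> 3r) \<plusminus> F(r)\<close>. Likewise
  \<open>F(m + r) - F(m - r) = L(m)F(r)\<close> since \<open>r\<close> is even. The increment is therefore
  \<open>F(m)L(m) (F(4m + 3r) - F(4m - 3r) + 2F(r) - 2F(r)L(r)\<^sup>2)\<close>. Since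
  \<open>F(3r) = F(r)(L(r)\<^sup>2 - 1)\<close>, the bracket equals \<open>F(3r)(L(4m) - 2)\<close>, and
  \<open>L(4m) - 2 = 5F(2m)\<^sup>2\<close> turns the increment into \<open>5F(3r)F(2m)\<^sup>3\<close>.

  The product formulas come from the addition theorems for \<open>F\<close> and \<open>L\<close>, which hold because a
  solution of the Fibonacci recurrence on the integers is determined by its values at 0 and 1.
\<close>

lemma fib_recurrence_unique:
  fixes g h :: "int \<Rightarrow> int"
  assumes g: "\<And>m. g m = g (m - 1) + g (m - 2)"
    and h: "\<And>m. h m = h (m - 1) + h (m - 2)"
    and "g 0 = h 0" and "g 1 = h 1"
  shows "g m = h m"
proof -
  \<comment> \<open>Two consecutive agreements propagate in both directions.\<close>
  have "g m = h m \<and> g (m + 1) = h (m + 1)"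
  proof (induction m rule: int_induct [where k = 0])
    case base
    then show ?case using assms(3,4) by simp
  next
    case (step1 i)
    then show ?case using g [of "i + 2"] h [of "i + 2"] by (simp add: algebra_simps)
  next
    case (step2 i)
    then show ?case using g [of "i + 1"] h [of "i + 1"] by simp
  qed
  then show ?thesis ..
qed

lemma lucasZ_eq_fibZ: "lucasZ m = fibZ (m + 1) + fibZ (m - 1)"
proof (rule fib_recurrence_unique [where m = m])
  show "lucasZ m = lucasZ (m - 1) + lucasZ (m - 2)" for m
    by (rule lucasZ_rec)
  show "fibZ (m + 1) + fibZ (m - 1) =
      fibZ (m - 1 + 1) + fibZ (m - 1 - 1) + (fibZ (m - 2 + 1) + fibZ (m - 2 - 1))" for m
    using fibZ_rec [of "m + 1"] fibZ_rec [of "m - 1"] by (simp add: algebra_simps)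
  show "lucasZ 0 = fibZ (0 + 1) + fibZ (0 - 1)"
    using fibZ_rec [of 1] by simp
  show "lucasZ 1 = fibZ (1 + 1) + fibZ (1 - 1)"
    using fibZ_rec [of 2] by simp
qed

lemma fibZ_add: "2 * fibZ (a + b) = fibZ a * lucasZ b + lucasZ a * fibZ b"
proof (rule fib_recurrence_unique [where m = b])
  show "2 * fibZ (a + m) = 2 * fibZ (a + (m - 1)) + 2 * fibZ (a + (m - 2))" for m
    using fibZ_rec [of "a + m"] by (simp add: algebra_simps)
  show "fibZ a * lucasZ m + lucasZ a * fibZ m =
      fibZ a * lucasZ (m - 1) + lucasZ a * fibZ (m - 1) +
      (fibZ a * lucasZ (m - 2) + lucasZ a * fibZ (m - 2))" for m
    by (subst fibZ_rec [of m], subst lucasZ_rec [of m]) (simp add: algebra_simps)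
  show "2 * fibZ (a + 1) = fibZ a * lucasZ 1 + lucasZ a * fibZ 1"
    using fibZ_rec [of "a + 1"] by (simp add: lucasZ_eq_fibZ [of a])
qed simp

lemma lucasZ_add: "2 * lucasZ (a + b) = lucasZ a * lucasZ b + 5 * fibZ a * fibZ b"
proof (rule fib_recurrence_unique [where m = b])
  show "2 * lucasZ (a + m) = 2 * lucasZ (a + (m - 1)) + 2 * lucasZ (a + (m - 2))" for m
    using lucasZ_rec [of "a + m"] by (simp add: algebra_simps)
  show "lucasZ a * lucasZ m + 5 * fibZ a * fibZ m =
      lucasZ a * lucasZ (m - 1) + 5 * fibZ a * fibZ (m - 1) +
      (lucasZ a * lucasZ (m - 2) + 5 * fibZ a * fibZ (m - 2))" for m
    by (subst fibZ_rec [of m], subst lucasZ_rec [of m]) (simp add: algebra_simps)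
  show "2 * lucasZ (a + 1) = lucasZ a * lucasZ 1 + 5 * fibZ a * fibZ 1"
    using fibZ_rec [of "a + 1"] fibZ_rec [of "a + 2"]
      lucasZ_eq_fibZ [of a] lucasZ_eq_fibZ [of "a + 1"]
    by (simp add: add.commute)
qed simp

text \<open>
  Multiplying by the parity sign turns the reversed sequence into a solution of the original
  recurrence.
\<close>

lemma fibZ_minus: "fibZ (- m) = (if even m then - fibZ m else fibZ m)"
proof -
  have "(if even m then - fibZ (- m) else fibZ (- m)) = fibZ m"
  proof (rule fib_recurrence_unique [where m = m])
    show "(if even m then - fibZ (- m) else fibZ (- m)) =
        (if even (m - 1) then - fibZ (- (m - 1)) else fibZ (- (m - 1))) +
        (if even (m - 2) then - fibZ (- (m - 2)) else fibZ (- (m - 2)))" for m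
      using fibZ_rec [of "2 - m"] by (simp add: algebra_simps)
    show "(if even (1::int) then - fibZ (- 1) else fibZ (- 1)) = fibZ 1"
      using fibZ_rec [of 1] by simp
  qed (simp_all flip: fibZ_rec)
  then show ?thesis by (auto split: if_splits)
qed

lemma lucasZ_minus: "lucasZ (- m) = (if even m then lucasZ m else - lucasZ m)"
  using fibZ_minus [of "m + 1"] fibZ_minus [of "m - 1"]
  by (auto simp: lucasZ_eq_fibZ [of m] lucasZ_eq_fibZ [of "- m"] minus_diff_commute)

lemma fibZ_double: "fibZ (2 * a) = fibZ a * lucasZ a"
  using fibZ_add [of a a] by simp

lemma fibZ_mult_lucasZ:
  assumes "even b"
  shows "fibZ a * lucasZ b = fibZ (a + b) + fibZ (a - b)"
  using fibZ_add [of a b] fibZ_add [of a "- b"] assms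
  by (simp add: fibZ_minus lucasZ_minus)

lemma lucasZ_mult_fibZ:
  assumes "even b"
  shows "lucasZ a * fibZ b = fibZ (a + b) - fibZ (a - b)"
  using fibZ_add [of a b] fibZ_add [of a "- b"] assms
  by (simp add: fibZ_minus lucasZ_minus)

lemma lucasZ_double_minus_2:
  assumes "even a"
  shows "lucasZ (2 * a) - 2 = 5 * (fibZ a)\<^sup>2"
  using lucasZ_add [of a a] lucasZ_add [of a "- a"] assms
  by (simp add: fibZ_minus lucasZ_minus power2_eq_square)

lemma fibZ_triple:
  assumes "even r"
  shows "fibZ (3 * r) = fibZ r * ((lucasZ r)\<^sup>2 - 1)"
  using fibZ_mult_lucasZ [OF assms, of "2 * r"]
  by (simp add: fibZ_double power2_eq_square right_diff_distrib mult.assoc)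

text \<open>
  Since \<open>F\<close> is odd on even indices, replacing \<open>r\<close> by \<open>- r\<close> gives the companion formula with value \<open>F(4m - 3r) - F(r)\<close>, so one
  statement serves both ends of the telescoping difference.
\<close>

lemma fibZ_lucasZ_triple_product:
  assumes "even r"
  shows "fibZ (m + r) * lucasZ (m + r) * lucasZ (2 * m + r) = fibZ (4 * m + 3 * r) + fibZ r"
proof -
  have "fibZ (2 * (m + r)) * lucasZ (2 * m + r) =
      fibZ (2 * (m + r) + (2 * m + r)) + fibZ (2 * (m + r) - (2 * m + r))"
    using assms by (intro fibZ_mult_lucasZ) simp
  then show ?thesis
    by (simp add: fibZ_double [symmetric] algebra_simps)
qed

lemma fibZ_cube_telescope:
  assumes "even r"
  shows "fibZ m * fibZ (m + r) *
      (lucasZ m * lucasZ (m + r) * lucasZ (2 * m + r) - 2 * (lucasZ r)\<^sup>2) -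
    fibZ (m - r) * fibZ m *
      (lucasZ (m - r) * lucasZ m * lucasZ (2 * m - r) - 2 * (lucasZ r)\<^sup>2) =
    5 * fibZ (3 * r) * fibZ (2 * m) ^ 3"  (is "?lhs = _")
proof -
  have upper: "fibZ (m + r) * lucasZ (m + r) * lucasZ (2 * m + r) = fibZ (4 * m + 3 * r) + fibZ r"
    using fibZ_lucasZ_triple_product [OF assms] .
  have lower: "fibZ (m - r) * lucasZ (m - r) * lucasZ (2 * m - r) = fibZ (4 * m - 3 * r) - fibZ r"
    using fibZ_lucasZ_triple_product [of "- r" m] assms by (simp add: fibZ_minus)
  have "?lhs = fibZ m *
      (lucasZ m * (fibZ (m + r) * lucasZ (m + r) * lucasZ (2 * m + r)
          - fibZ (m - r) * lucasZ (m - r) * lucasZ (2 * m - r))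
        - 2 * (lucasZ r)\<^sup>2 * (fibZ (m + r) - fibZ (m - r)))"
    by (simp add: algebra_simps)
  also have "\<dots> = fibZ m * (lucasZ m * (fibZ (4 * m + 3 * r) - fibZ (4 * m - 3 * r) + 2 * fibZ r)
        - 2 * (lucasZ r)\<^sup>2 * (lucasZ m * fibZ r))"
    unfolding upper lower lucasZ_mult_fibZ [OF assms] by (simp add: algebra_simps)
  also have "\<dots> = fibZ m * lucasZ m *
      (lucasZ (4 * m) * fibZ (3 * r) - 2 * (fibZ r * ((lucasZ r)\<^sup>2 - 1)))"
  proof -
    have "fibZ (4 * m + 3 * r) - fibZ (4 * m - 3 * r) = lucasZ (4 * m) * fibZ (3 * r)"
      using assms by (simp add: lucasZ_mult_fibZ)
    then show ?thesis by (simp only:) (simp add: algebra_simps)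
  qed
  also have "\<dots> = fibZ (2 * m) * fibZ (3 * r) * (lucasZ (2 * (2 * m)) - 2)"
    unfolding fibZ_triple [OF assms, symmetric] fibZ_double [of m] by (simp add: algebra_simps)
  also have "\<dots> = 5 * fibZ (3 * r) * fibZ (2 * m) ^ 3"
    by (subst lucasZ_double_minus_2) (simp_all add: power2_eq_square power3_eq_cube)
  finally show ?thesis .
qed

theorem theorem3p2:
  fixes r n :: int
  assumes "even r" and "n > 0"
  shows "5 * fibZ (3 * r) * (\<Sum>k=1..n. fibZ (2 * r * k) ^ 3) =
    fibZ (r * n) * fibZ (r * n + r) *
      (lucasZ (r * n) * lucasZ (r * n + r) * lucasZ (2 * r * n + r) - 2 * (lucasZ r)\<^sup>2)"
proof -
  have "0 \<le> n" using assms(2) by simp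
  then show ?thesis
  proof (induction n rule: int_ge_induct)
    case base
    show ?case by simp
  next
    case (step i)
    define m where "m = r * (i + 1)"
    have "{1..i + 1} = insert (i + 1) {1..i}" using step.hyps by auto
    then have "(\<Sum>k=1..i + 1. fibZ (2 * r * k) ^ 3) =
        fibZ (2 * m) ^ 3 + (\<Sum>k=1..i. fibZ (2 * r * k) ^ 3)"
      by (simp add: m_def mult.assoc)
    moreover have "r * i = m - r" "2 * r * i + r = 2 * m - r" "2 * r * (i + 1) + r = 2 * m + r"
      by (simp_all add: m_def algebra_simps)
    ultimately show ?case
      using step.IH fibZ_cube_telescope [OF assms(1), of m]
      by (simp only: distrib_left [of "5 * fibZ (3 * r)"] flip: m_def) simp
  qed
qed

end
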